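(* Let $t_0<\tau_0\le+\infty$ and let $a,b,c,d,a_1,b_1,c_1,d_1$ be real-valued continuous functions on $[t_0,\tau_0)$. Let $y_1(t)$ be a solution on $[t_0,\tau_0)$ of $$y'+a_1(t)y^3+b_1(t)y^2+c_1(t)y+d_1(t)=0,$$ and let $\eta(t)$ be a solution on $[t_0,\tau_0)$ of the differential inequality $$\eta'+a(t)\eta^3+b(t)\eta^2+c(t)\eta+d(t)\le 0$$ with $\eta(t_0)\le y_1(t_0)$. Assume that $a(t)<0$ almost everywhere on $[t_0,\tau_0)$, that the function $\frac{b^2(t)}{a(t)}$ is locally integrable on $[t_0,\tau_0)$, and that for some $\gamma\in[\eta(t_0),y_1(t_0)]$, $$\gamma-y_1(t_0)+\int_{t_0}^{t}\exp\Big\{\int_{t_0}^{\tau}\Big[c(s)-\frac{b^2(s)}{a(s)}\Big]ds\Big\}\Big[(a_1(\tau)-a(\tau))y_1^3(\tau)+(b_1(\tau)-b(\tau))y_1^2(\tau)+(c_1(\tau)-c(\tau))y_1(\tau)+d_1(\tau)-d(\tau)\Big]d\tau\le 0$$ for all $t\in[t_0,\tau_0)$. Then every solution $y(t)$ of $$y'+a(t)y^3+b(t)y^2+c(t)y+d(t)=0$$ with $y(t_0)\in[\eta(t_0),\gamma]$ exists on $[t_0,\tau_0)$ and $$\eta(t)\le y(t)\le y_1(t),\qquad t_0\le t<\tau_0.$$ Furthermore, if $\eta(t_0)<y(t_0)$, then $\eta(t)<y(t)$ for all $t\in[t_0,\tau_0)$; and if $y(t_0)<y_1(t_0)$, then $y(t)<y_1(t)$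 for all $t\in[t_0,\tau_0)$.
   Context: All functions are real-valued. A solution of a differential equation or differential inequality on an interval is a differentiable function satisfying it at every point of the interval (one-sided derivative at an included endpoint). "A solution $y$ of the equation exists on $[t_0,\tau_0)$" means that the solution of the initial value problem with the given value at $t_0$ is defined on all of $[t_0,\tau_0)$. "Locally integrable on $[t_0,\tau_0)$" means Lebesgue integrable on $[t_0,t_1]$ for every $t_1\in(t_0,\tau_0)$. *)

theory Defs
  imports "HOL-Analysis.Analysis"
begin

text \<open>The interval \<open>[t0, \<tau>0)\<close>; the right end point may be \<open>\<infinity>\<close>.\<close>

definition right_open_ivl :: "real \<Rightarrow> ereal \<Rightarrow> real set" where
  "right_open_ivl t0 \<tau>0 = {t. t0 \<le> t \<and> ereal t < \<tau>0}"

text \<open>The derivative is taken within the interval, hence is one-sided at an included end point.\<close>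

definition cubic_solution ::
  "(real \<Rightarrow> real) \<Rightarrow> (real \<Rightarrow> real) \<Rightarrow> (real \<Rightarrow> real) \<Rightarrow> (real \<Rightarrow> real) \<Rightarrow> real set \<Rightarrow> (real \<Rightarrow> real) \<Rightarrow> bool" where
  "cubic_solution a b c d I y \<longleftrightarrow>
     (\<forall>t\<in>I. \<exists>y'. (y has_real_derivative y') (at t within I) \<and>
        y' + a t * y t ^ 3 + b t * y t ^ 2 + c t * y t + d t = 0)"

definition cubic_subsolution ::
  "(real \<Rightarrow> real) \<Rightarrow> (real \<Rightarrow> real) \<Rightarrow> (real \<Rightarrow> real) \<Rightarrow> (real \<Rightarrow> real) \<Rightarrow> real set \<Rightarrow> (real \<Rightarrow> real) \<Rightarrow> bool" where
  "cubic_subsolution a b c d I y \<longleftrightarrow>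
     (\<forall>t\<in>I. \<exists>y'. (y has_real_derivative y') (at t within I) \<and>
        y' + a t * y t ^ 3 + b t * y t ^ 2 + c t * y t + d t \<le> 0)"

text \<open>The solution of the initial value problem \<open>y(t0) = y0\<close> is defined on all of
  \<open>[t0, \<tau>0)\<close>: there is a solution on the whole interval, and every solution with this
  initial value on a shorter interval \<open>[t0, T)\<close> is a restriction of it (so that no solution
  breaks down before \<open>\<tau>0\<close>).\<close>

definition cubic_ivp_solution_exists_on ::
  "(real \<Rightarrow> real) \<Rightarrow> (real \<Rightarrow> real) \<Rightarrow> (real \<Rightarrow> real) \<Rightarrow> (real \<Rightarrow> real) \<Rightarrow> real \<Rightarrow> ereal \<Rightarrow> real \<Rightarrow> bool" where
  "cubic_ivp_solution_exists_on a b c d t0 \<tau>0 y0 \<longleftrightarrow>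
     (\<exists>y. cubic_solution a b c d (right_open_ivl t0 \<tau>0) y \<and> y t0 = y0 \<and>
        (\<forall>T z. ereal t0 < T \<and> T \<le> \<tau>0 \<and>
            cubic_solution a b c d (right_open_ivl t0 T) z \<and> z t0 = y0 \<longrightarrow>
            (\<forall>t\<in>right_open_ivl t0 T. z t = y t)))"

end

theory Submission
  imports Defs
begin

text \<open>
  Let \<open>g\<close> be the divided difference, taken at two solutions, of the cubic
  \<open>x \<mapsto> a x^3 + b x^2 + c x\<close>. Differences of (sub)solutions obey first order linear relations with
  coefficient \<open>g\<close>, and everything follows from their integrating factor \<open>exp (\<integral> g)\<close>.

  The lower bound is immediate: \<open>(y - \<eta>)' + g (y - \<eta>) \<ge> 0\<close>, so \<open>exp (\<integral> g) (y - \<eta>)\<close> is nondecreasing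
  (\<open>cubic_subsolution_le_solution\<close>). The same argument gives uniqueness.

  For the upper bound, \<open>w = y1 - y\<close> satisfies \<open>w' + g w + F = 0\<close>, where \<open>F\<close> is the bracket in the
  integral condition, hence \<open>exp (\<integral> g) w = w(t0) - \<integral> exp (\<integral> g) F\<close>. The coefficient \<open>g\<close> depends on the
  unknown \<open>y\<close>, whereas the condition is about \<open>H = c - b^2/a\<close>. Where \<open>a < 0\<close>, completing the square
  gives \<open>g \<le> H\<close> (\<open>cubic_quotient_le\<close>). Therefore \<open>exp (\<integral> g) = m exp (\<integral> H)\<close> with a weight \<open>m\<close> that
  decreases from \<open>1\<close>, and by the second mean value theorem such a weight cannot push the integral
  of \<open>exp (\<integral> H) F\<close> above a bound \<open>w(t0) \<ge> 0\<close> that holds for all its partial integrals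
  (\<open>linear_comparison_with_majorant\<close>). So \<open>w \<ge> 0\<close>.

  Strictness is delicate only because the partial integrals may reach \<open>w(t0)\<close>. If \<open>w(t0) > 0\<close>, then
  \<open>w\<close> is nonzero near \<open>t0\<close>, and there \<open>g < H\<close> almost everywhere, because \<open>(y1 - y)^2\<close> appears in the
  completed square. So \<open>m < 1\<close> right after \<open>t0\<close>, while the partial integrals start at \<open>0\<close>
  (\<open>weighted_integral_strict_bound\<close>).

  Finally, a solution with initial value in \<open>[\<eta>(t0), \<gamma>]\<close> lies between \<open>\<eta>\<close> and \<open>y1\<close> for as
  long as it exists, and this a priori bound gives existence on the whole interval: the argument of the cubic is clipped to a large interval, the
  resulting Lipschitz equation is solved globally by a contraction argument,
  and the clipping is seen never to act
  (\<open>cubic_solution_exists_of_a_priori_bound\<close>).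
\<close>

section \<open>Derivatives within an interval and integrating factors\<close>

text \<open>One-sided derivatives at the end points are the ones that solutions on \<open>[t0, \<tau>0)\<close> have at
  \<open>t0\<close>, hence the derivative within \<open>{p..q}\<close> instead of a two-sided one.\<close>

lemma mono_of_nonneg_derivative_within:
  fixes f :: "real \<Rightarrow> real"
  assumes "p \<le> q"
    and "\<And>t. t \<in> {p..q} \<Longrightarrow> (f has_real_derivative f' t) (at t within {p..q})"
    and "\<And>t. t \<in> {p..q} \<Longrightarrow> 0 \<le> f' t"
  shows "f p \<le> f q"
proof -
  obtain s where "s \<in> {p..q}" "f q - f p = f' s * (q - p)"
    using mvt_very_simple[of p q f "\<lambda>t. (*) (f' t)"] assms(1,2)
    by (auto simp: has_field_derivative_def)
  moreover from this have "0 \<le> f' s * (q - p)"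
    using assms(1,3) by simp
  ultimately show ?thesis by linarith
qed

lemma integrating_factor_derivative:
  fixes g w :: "real \<Rightarrow> real"
  assumes "continuous_on {p..q} g" "t \<in> {p..q}"
    and "(w has_real_derivative D) (at t within {p..q})"
  shows "((\<lambda>t. exp (integral {p..t} g) * w t) has_real_derivative
            exp (integral {p..t} g) * (D + g t * w t)) (at t within {p..q})"
  using integral_has_real_derivative[OF assms(1,2)] assms(3)
  by (auto intro!: derivative_eq_intros simp: algebra_simps)

section \<open>Integrals with a decreasing weight\<close>

text \<open>Bonnet's form of the second mean value theorem, rewritten so that \<open>f\<close> enters only through its
  primitive \<open>\<lambda>t. integral {p..t} f\<close>. The base point \<open>p\<close> of the primitive may lie to the left of
  the interval of integration, so that the formula can be used on adjacent intervals with one and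
  the same primitive. It takes the place of an integration by parts that would move the
  derivative onto the weight.\<close>

lemma second_mean_value_decreasing_weight:
  fixes f m :: "real \<Rightarrow> real"
  assumes "p \<le> r" "r \<le> q" and f: "f integrable_on {p..q}"
    and m: "\<And>s t. r \<le> s \<Longrightarrow> s \<le> t \<Longrightarrow> t \<le> q \<Longrightarrow> m t \<le> m s"
  obtains s where "s \<in> {r..q}"
    "((\<lambda>t. m t * f t) has_integral
       ((m r - m q) * integral {p..s} f + m q * integral {p..q} f - m r * integral {p..r} f)) {r..q}"
proof -
  have fi: "f integrable_on {s..t}" if "p \<le> s" "t \<le> q" for s t
    using f that by (auto intro: integrable_subinterval_real)
  obtain s where s: "s \<in> {r..q}"
    and eq: "((\<lambda>t. - m t * f t) has_integral
               (- m r * integral {r..s} f + - m q * integral {s..q} f)) {r..q}"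
    using second_mean_value_theorem_full[OF fi, of r q "\<lambda>t. - m t"] m assms(1,2) by force
  have split: "integral {p..u} f + integral {u..v} f = integral {p..v} f"
    if "p \<le> u" "u \<le> v" "v \<le> q" for u v
    using fi that by (intro Henstock_Kurzweil_Integration.integral_combine) auto
  have rs: "integral {r..s} f = integral {p..s} f - integral {p..r} f"
    and sq: "integral {s..q} f = integral {p..q} f - integral {p..s} f"
    using split[of r s] split[of s q] s assms(1,2) by auto
  have "- (- m r * integral {r..s} f + - m q * integral {s..q} f)
      = (m r - m q) * integral {p..s} f + m q * integral {p..q} f - m r * integral {p..r} f"
    unfolding rs sq by (simp add: algebra_simps)
  with has_integral_neg[OF eq] s show thesis by (intro that[of s]) auto
qed

text \<open>By the second mean value theorem the weighted integral is a convex combination, with weights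
  \<open>1 - m q\<close> and \<open>m q\<close>, of values of the primitive of \<open>f\<close>.\<close>

lemma weighted_integral_bound:
  fixes f m :: "real \<Rightarrow> real"
  assumes "p \<le> q" and f: "f integrable_on {p..q}"
    and m: "\<And>s t. p \<le> s \<Longrightarrow> s \<le> t \<Longrightarrow> t \<le> q \<Longrightarrow> m t \<le> m s"
    and m1: "m p = 1" and mpos: "0 \<le> m q"
    and bound: "\<And>t. t \<in> {p..q} \<Longrightarrow> integral {p..t} f \<le> K"
  shows "integral {p..q} (\<lambda>t. m t * f t) \<le> K"
proof -
  obtain s where s: "s \<in> {p..q}"
    and eq: "((\<lambda>t. m t * f t) has_integral
       ((m p - m q) * integral {p..s} f + m q * integral {p..q} f - m p * integral {p..p} f)) {p..q}"
    using second_mean_value_decreasing_weight[OF order_refl \<open>p \<le> q\<close> f, of m] m by blast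
  have "(m p - m q) * integral {p..s} f + m q * integral {p..q} f \<le> (m p - m q) * K + m q * K"
    using bound s m[of p q] \<open>p \<le> q\<close> mpos by (intro add_mono mult_left_mono) auto
  with eq show ?thesis by (simp add: integral_unique m1 algebra_simps)
qed

text \<open>The primitive of \<open>f\<close> vanishes at \<open>p\<close>, so it stays below \<open>K/2\<close> on some \<open>{p..r}\<close>. Using the
  second mean value theorem on \<open>{p..r}\<close> and on \<open>{r..q}\<close> separately gives a convex combination of
  three values of the primitive. The first of them is at most \<open>K/2\<close>, and its weight \<open>1 - m r\<close> is
  positive. On \<open>{p..q}\<close> at once, the only intermediate point might be one where the primitive
  equals \<open>K\<close>.\<close>

lemma weighted_integral_strict_bound:
  fixes f m :: "real \<Rightarrow> real"
  assumes "p \<le> q" and f: "f integrable_on {p..q}"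
    and m: "\<And>s t. p \<le> s \<Longrightarrow> s \<le> t \<Longrightarrow> t \<le> q \<Longrightarrow> m t \<le> m s"
    and m1: "m p = 1" and mpos: "0 \<le> m q"
    and m_less: "\<And>t. p < t \<Longrightarrow> t \<le> q \<Longrightarrow> m t < 1"
    and bound: "\<And>t. t \<in> {p..q} \<Longrightarrow> integral {p..t} f \<le> K" and "0 < K"
  shows "integral {p..q} (\<lambda>t. m t * f t) < K"
proof (cases "p = q")
  case True
  then show ?thesis using \<open>0 < K\<close> by simp
next
  case False
  with \<open>p \<le> q\<close> have "p < q" by simp
  have "continuous_on {p..q} (\<lambda>t. integral {p..t} f)"
    using f by (rule indefinite_integral_continuous_1)
  then have "((\<lambda>t. integral {p..t} f) \<longlongrightarrow> integral {p..p} f) (at p within {p..q})"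
    unfolding continuous_on_def using \<open>p \<le> q\<close> by (metis atLeastAtMost_iff order_refl)
  then have "\<forall>\<^sub>F t in at p within {p..q}. integral {p..t} f < K/2"
    using \<open>0 < K\<close> by (intro order_tendstoD) auto
  then obtain e where "0 < e"
    and e: "\<And>t. t \<in> {p..q} \<Longrightarrow> t \<noteq> p \<Longrightarrow> dist t p < e \<Longrightarrow> integral {p..t} f < K/2"
    by (auto simp: eventually_at)
  define r where "r = min q (p + e/2)"
  have r: "p < r" "r \<le> q" "r \<le> p + e/2" using \<open>p < q\<close> \<open>0 < e\<close> by (auto simp: r_def)
  have small: "integral {p..t} f \<le> K/2" if "t \<in> {p..r}" for t
    using e[of t] that r \<open>0 < K\<close> \<open>0 < e\<close> by (cases "t = p") (auto simp: dist_real_def)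
  have mr: "0 \<le> m q" "m q \<le> m r" "m r < 1" using m[of r q] m_less[of r] mpos r by auto
  obtain s1 where s1: "s1 \<in> {p..r}"
    and eq1: "((\<lambda>t. m t * f t) has_integral
       ((m p - m r) * integral {p..s1} f + m r * integral {p..r} f - m p * integral {p..p} f)) {p..r}"
  proof (rule second_mean_value_decreasing_weight[of p p r f m])
    show "f integrable_on {p..r}" using f r by (auto intro: integrable_subinterval_real)
  qed (use m r in auto)
  obtain s2 where s2: "s2 \<in> {r..q}"
    and eq2: "((\<lambda>t. m t * f t) has_integral
       ((m r - m q) * integral {p..s2} f + m q * integral {p..q} f - m r * integral {p..r} f)) {r..q}"
    using second_mean_value_decreasing_weight[of p r q f m] m f r by auto
  have "integral {p..q} (\<lambda>t. m t * f t)
      = (1 - m r) * integral {p..s1} f + (m r - m q) * integral {p..s2} f + m q * integral {p..q} f"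
    using has_integral_combine[OF _ _ eq1 eq2] r m1 by (simp add: integral_unique)
  also have "\<dots> \<le> (1 - m r) * (K/2) + (m r - m q) * K + m q * K"
    using small[of s1] bound[of s2] bound[of q] s1 s2 r mr by (intro add_mono mult_left_mono) auto
  also have "\<dots> < K"
    using mult_pos_pos[of "1 - m r" "K"] mr \<open>0 < K\<close> by (simp add: field_simps)
  finally show ?thesis .
qed

section \<open>The divided difference of a cubic\<close>

text \<open>The divided difference, between \<open>u\<close> and \<open>v\<close>, of the polynomial with coefficients
  \<open>a\<close>, \<open>b\<close>, \<open>c\<close> and any constant term; it linearises the equation for the difference of two
  solutions, and it makes sense also where they meet.\<close>

definition cubic_quotient :: "real \<Rightarrow> real \<Rightarrow> real \<Rightarrow> real \<Rightarrow> real \<Rightarrow> real" where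
  "cubic_quotient a b c u v = a * (u^2 + u * v + v^2) + b * (u + v) + c"

lemma cubic_diff:
  "(a * u^3 + b * u^2 + c * u) - (a * v^3 + b * v^2 + c * v) = cubic_quotient a b c u v * (u - v)"
  unfolding cubic_quotient_def by algebra

lemma continuous_on_cubic_quotient:
  assumes "continuous_on S a" "continuous_on S b" "continuous_on S c"
    and "continuous_on S u" "continuous_on S v"
  shows "continuous_on S (\<lambda>t. cubic_quotient (a t) (b t) (c t) (u t) (v t))"
  unfolding cubic_quotient_def using assms by (intro continuous_intros)

text \<open>Completing the square, with \<open>s = u + v\<close>: since \<open>u^2 + u * v + v^2 = 3/4 * s^2 + 1/4 * (u - v)^2\<close>,
  splitting off \<open>(b + a * s / 2)^2\<close> from \<open>b^2 + a * b * s + a^2 * (u^2 + u * v + v^2)\<close> leaves a sum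
  of squares. Its term \<open>(u - v)^2\<close> is what makes the inequality below strict for \<open>u \<noteq> v\<close>.\<close>

lemma cubic_quotient_square:
  assumes "a \<noteq> 0"
  shows "c - b^2 / a - cubic_quotient a b c u v
    = ((b + a * (u + v) / 2)^2 + a^2 * ((u + v)^2 / 2 + (u - v)^2 / 4)) / (- a)"
  using assms unfolding cubic_quotient_def by (simp add: field_simps power2_eq_square)

lemma cubic_quotient_le:
  assumes "a < 0"
  shows "cubic_quotient a b c u v \<le> c - b^2 / a"
proof -
  have "0 \<le> c - b^2 / a - cubic_quotient a b c u v"
    unfolding cubic_quotient_square[OF less_imp_neq[OF assms]]
    using assms by (intro divide_nonneg_pos add_nonneg_nonneg mult_nonneg_nonneg) auto
  then show ?thesis by simp
qed

lemma cubic_quotient_less: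
  assumes "a < 0" "u \<noteq> v"
  shows "cubic_quotient a b c u v < c - b^2 / a"
proof -
  have "0 < c - b^2 / a - cubic_quotient a b c u v"
    unfolding cubic_quotient_square[OF less_imp_neq[OF assms(1)]]
    using assms by (intro divide_pos_pos add_nonneg_pos mult_pos_pos) auto
  then show ?thesis by simp
qed

section \<open>Comparison of integrals\<close>

lemma integral_mono_off_negligible:
  fixes f g :: "real \<Rightarrow> real"
  assumes "f integrable_on S" "g integrable_on S" "negligible N"
    and "\<And>x. x \<in> S - N \<Longrightarrow> f x \<le> g x"
  shows "integral S f \<le> integral S g"
proof -
  define h where "h x = (if x \<in> N then f x else g x)" for x
  have "h integrable_on S"
    using assms(2,3) by (rule integrable_spike) (simp add: h_def)
  then have "integral S f \<le> integral S h"
    using assms(1,4) by (intro integral_le) (auto simp: h_def)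
  also have "integral S h = integral S g"
    using assms(3) by (rule integral_spike) (simp add: h_def)
  finally show ?thesis .
qed

text \<open>Continuity is required only near \<open>r\<close>: the function \<open>b^2 / a\<close> need not be continuous
  where \<open>a\<close> vanishes.\<close>

lemma integral_less_of_less_at_point:
  fixes f g :: "real \<Rightarrow> real"
  assumes f: "f integrable_on {p..q}" and g: "g integrable_on {p..q}" and N: "negligible N"
    and le: "\<And>x. x \<in> {p..q} - N \<Longrightarrow> f x \<le> g x"
    and r: "p < r" "r < q" "f r < g r" "0 < e"
    and cont: "continuous_on (ball r e) f" "continuous_on (ball r e) g"
  shows "integral {p..q} f < integral {p..q} g"
proof -
  define U where "U = ball r e \<inter> {p<..<q}"
  have "open U" "r \<in> U" using r by (auto simp: U_def)
  have "continuous_on U (\<lambda>t. g t - f t)"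
    using cont by (auto simp: U_def intro!: continuous_intros elim: continuous_on_subset)
  then have "open ((\<lambda>t. g t - f t) -` {0<..} \<inter> U)"
    using \<open>open U\<close> by (simp add: continuous_on_open_vimage)
  then obtain \<delta> where \<delta>: "0 < \<delta>" "cball r \<delta> \<subseteq> (\<lambda>t. g t - f t) -` {0<..} \<inter> U"
    using \<open>r \<in> U\<close> r(3) unfolding open_contains_cball by force
  have "{r..r+\<delta>} \<subseteq> cball r \<delta>" by (auto simp: dist_real_def)
  with \<delta>(2) have "{r..r+\<delta>} \<subseteq> (\<lambda>t. g t - f t) -` {0<..} \<inter> U" by blast
  then have sub: "{r..r+\<delta>} \<subseteq> ball r e" "{r..r+\<delta>} \<subseteq> {p<..<q}"
    and less: "\<And>t. t \<in> {r..r+\<delta>} \<Longrightarrow> f t < g t"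
    unfolding U_def by (blast, blast, force)
  have "r + \<delta> \<in> {p<..<q}" using subsetD[OF sub(2), of "r + \<delta>"] \<delta>(1) by auto
  then have ord: "p \<le> r" "r \<le> r + \<delta>" "r + \<delta> \<le> q" using \<delta>(1) r by auto
  have part: "h integrable_on {s..t}" if "h integrable_on {p..q}" "p \<le> s" "t \<le> q" for h :: "real \<Rightarrow> real" and s t
    using that by (auto intro: integrable_subinterval_real)
  have split: "integral {p..q} h = integral {p..r} h + integral {r..r+\<delta>} h + integral {r+\<delta>..q} h"
    if "h integrable_on {p..q}" for h :: "real \<Rightarrow> real"
    using Henstock_Kurzweil_Integration.integral_combine[of p r q h]
      Henstock_Kurzweil_Integration.integral_combine[of r "r+\<delta>" q h] ord that part[OF that, of r q] by simp
  have "integral {r..r+\<delta>} f < integral {r..r+\<delta>} g"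
    using \<delta>(1) less cont sub(1) by (intro integral_less_real) (auto elim: continuous_on_subset)
  moreover have "integral {p..r} f \<le> integral {p..r} g" "integral {r+\<delta>..q} f \<le> integral {r+\<delta>..q} g"
    using ord by (auto intro!: integral_mono_off_negligible[OF _ _ N] part f g le)
  ultimately show ?thesis
    unfolding split[OF f] split[OF g] by linarith
qed

text \<open>For the strict inequality, \<open>u\<close> and \<open>v\<close> stay apart just after \<open>p\<close>, and every interval contains
  points with \<open>a t < 0\<close>. At such a point the integrands differ, and they are continuous
  around it.\<close>

lemma integral_cubic_quotient:
  fixes a b c u v :: "real \<Rightarrow> real"
  assumes cont: "continuous_on {p..q} a" "continuous_on {p..q} b" "continuous_on {p..q} c"
      "continuous_on {p..q} u" "continuous_on {p..q} v"
    and N: "negligible N" and neg: "\<And>t. t \<in> {p..q} - N \<Longrightarrow> a t < 0"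
    and H: "(\<lambda>t. c t - b t^2 / a t) integrable_on {p..q}"
  shows "integral {p..q} (\<lambda>t. cubic_quotient (a t) (b t) (c t) (u t) (v t))
           \<le> integral {p..q} (\<lambda>t. c t - b t^2 / a t)"
    and "p < q \<Longrightarrow> u p \<noteq> v p \<Longrightarrow>
         integral {p..q} (\<lambda>t. cubic_quotient (a t) (b t) (c t) (u t) (v t))
           < integral {p..q} (\<lambda>t. c t - b t^2 / a t)"
proof -
  let ?g = "\<lambda>t. cubic_quotient (a t) (b t) (c t) (u t) (v t)"
  have contg: "continuous_on {p..q} ?g"
    using cont by (rule continuous_on_cubic_quotient)
  then have g: "?g integrable_on {p..q}"
    by (rule integrable_continuous_real)
  have le: "?g t \<le> c t - b t^2 / a t" if "t \<in> {p..q} - N" for t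
    using neg[OF that] by (rule cubic_quotient_le)
  show "integral {p..q} ?g \<le> integral {p..q} (\<lambda>t. c t - b t^2 / a t)"
    using g H N le by (rule integral_mono_off_negligible)
  assume "p < q" "u p \<noteq> v p"
  have "((\<lambda>t. u t - v t) \<longlongrightarrow> u p - v p) (at p within {p..q})"
    using cont(4,5) \<open>p < q\<close> unfolding continuous_on_def by (intro tendsto_diff) auto
  then have "\<forall>\<^sub>F t in at p within {p..q}. u t - v t \<noteq> 0"
    using \<open>u p \<noteq> v p\<close> by (intro tendsto_imp_eventually_ne) auto
  then obtain d where "0 < d"
    and d: "\<And>t. t \<in> {p..q} \<Longrightarrow> t \<noteq> p \<Longrightarrow> dist t p < d \<Longrightarrow> u t \<noteq> v t"
    by (auto simp: eventually_at)
  define U where "U = {p <..< min q (p + d)}"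
  have "open U" "U \<noteq> {}" "U \<subseteq> {p<..<q}"
    using \<open>p < q\<close> \<open>0 < d\<close> by (auto simp: U_def)
  then have "\<not> U \<subseteq> N"
    using open_not_negligible negligible_subset N by blast
  then obtain r where r: "r \<in> U" "r \<notin> N" by blast
  then have rpq: "p < r" "r < q" "a r < 0" "u r \<noteq> v r"
    using \<open>U \<subseteq> {p<..<q}\<close> neg[of r] d[of r] by (auto simp: U_def dist_real_def)
  have "continuous_on {p<..<q} a"
    using cont(1) by (rule continuous_on_subset) auto
  then have "open (a -` {..<0} \<inter> {p<..<q})"
    by (simp add: continuous_on_open_vimage)
  then obtain e where e: "0 < e" "ball r e \<subseteq> a -` {..<0} \<inter> {p<..<q}"
    using rpq unfolding open_contains_ball by force
  then have sub: "ball r e \<subseteq> {p..q}" and nz: "\<And>t. t \<in> ball r e \<Longrightarrow> a t \<noteq> 0" by force+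
  show "integral {p..q} ?g < integral {p..q} (\<lambda>t. c t - b t^2 / a t)"
  proof (rule integral_less_of_less_at_point[OF g H N le rpq(1,2) _ e(1)])
    show "?g r < c r - b r^2 / a r" using rpq(3,4) by (rule cubic_quotient_less)
    show "continuous_on (ball r e) ?g" using contg sub by (rule continuous_on_subset)
    have "continuous_on (ball r e) a" "continuous_on (ball r e) b" "continuous_on (ball r e) c"
      using cont(1,2,3) sub by (auto elim: continuous_on_subset)
    then show "continuous_on (ball r e) (\<lambda>t. c t - b t^2 / a t)"
      using nz by (intro continuous_intros) auto
  qed
qed

section \<open>A linear equation with a majorised coefficient\<close>

text \<open>The integrating factor \<open>exp (integral {p..t} g)\<close> is \<open>m t\<close> times the one made from the majorant
  \<open>H\<close>, where \<open>m t = exp (integral {p..t} g - integral {p..t} H)\<close> decreases from \<open>1\<close>. Solving the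
  linear equation gives
  \<open>exp (integral {p..q} g) * w q = w p - integral {p..q} (\<lambda>t. m t * f t)\<close>
  with \<open>f t = exp (integral {p..t} H) * F t\<close>, and the hypothesis bounds the primitive of \<open>f\<close>
  by \<open>w p\<close>.\<close>

lemma linear_comparison_with_majorant:
  fixes w g F H :: "real \<Rightarrow> real"
  assumes "p \<le> q"
    and g: "continuous_on {p..q} g" and F: "continuous_on {p..q} F"
    and H: "H integrable_on {p..q}"
    and w: "\<And>t. t \<in> {p..q} \<Longrightarrow> (w has_real_derivative - (g t * w t) - F t) (at t within {p..q})"
    and gH: "\<And>s t. p \<le> s \<Longrightarrow> s \<le> t \<Longrightarrow> t \<le> q \<Longrightarrow> integral {s..t} g \<le> integral {s..t} H"
    and bound: "\<And>t. t \<in> {p..q} \<Longrightarrow> integral {p..t} (\<lambda>s. exp (integral {p..s} H) * F s) \<le> w p"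
  shows "0 \<le> w q"
    and "0 < w p \<Longrightarrow> (\<And>t. p < t \<Longrightarrow> t \<le> q \<Longrightarrow> integral {p..t} g < integral {p..t} H) \<Longrightarrow> 0 < w q"
proof -
  define m where "m t = exp (integral {p..t} g - integral {p..t} H)" for t
  define f where "f t = exp (integral {p..t} H) * F t" for t
  have gi: "g integrable_on {p..q}"
    using g by (rule integrable_continuous_real)
  have "continuous_on {p..q} f"
    unfolding f_def using indefinite_integral_continuous_1[OF H] F by (intro continuous_intros)
  then have fi: "f integrable_on {p..q}"
    by (rule integrable_continuous_real)
  have m: "m t \<le> m s" if "p \<le> s" "s \<le> t" "t \<le> q" for s t
  proof -
    have "integral {p..t} h = integral {p..s} h + integral {s..t} h"
      if "h integrable_on {p..q}" for h :: "real \<Rightarrow> real"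
      using Henstock_Kurzweil_Integration.integral_combine[of p s t h]
        integrable_subinterval_real[OF that, of p t] \<open>p \<le> s\<close> \<open>s \<le> t\<close> \<open>t \<le> q\<close> by simp
    from this[OF gi] this[OF H] gH[OF that] show ?thesis by (simp add: m_def)
  qed
  \<comment> \<open>The factor \<open>exp (integral {p..t} H)\<close> cancels in \<open>m t * f t\<close>, so the integrand is the continuous
    \<open>exp (integral {p..t} g) * F t\<close>.\<close>
  have "((\<lambda>t. exp (integral {p..t} g) * w t) has_real_derivative - (m t * f t)) (at t within {p..q})"
    if t: "t \<in> {p..q}" for t
    using integrating_factor_derivative[OF g t w[OF t]] by (simp add: m_def f_def exp_diff)
  then have "((\<lambda>t. - (m t * f t)) has_integral
      (exp (integral {p..q} g) * w q - exp (integral {p..p} g) * w p)) {p..q}"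
    using \<open>p \<le> q\<close> by (intro fundamental_theorem_of_calculus)
      (simp_all flip: has_real_derivative_iff_has_vector_derivative)
  from has_integral_neg[OF this]
  have "((\<lambda>t. m t * f t) has_integral (w p - exp (integral {p..q} g) * w q)) {p..q}"
    by simp
  then have eq: "exp (integral {p..q} g) * w q = w p - integral {p..q} (\<lambda>t. m t * f t)"
    by (simp add: integral_unique)
  have "integral {p..q} (\<lambda>t. m t * f t) \<le> w p"
    using \<open>p \<le> q\<close> fi m bound unfolding f_def[symmetric]
    by (intro weighted_integral_bound) (auto simp: m_def)
  with eq have "0 \<le> exp (integral {p..q} g) * w q" by simp
  then show "0 \<le> w q" by (simp add: zero_le_mult_iff)
  assume "0 < w p" and less: "\<And>t. p < t \<Longrightarrow> t \<le> q \<Longrightarrow> integral {p..t} g < integral {p..t} H"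
  then have "integral {p..q} (\<lambda>t. m t * f t) < w p"
    using \<open>p \<le> q\<close> fi m bound unfolding f_def[symmetric]
    by (intro weighted_integral_strict_bound) (auto simp: m_def)
  with eq have "0 < exp (integral {p..q} g) * w q" by simp
  then show "0 < w q" by (simp add: zero_less_mult_iff)
qed

section \<open>Existence for Lipschitz right-hand sides\<close>

text \<open>Picard iteration as a contraction. To reach the whole interval in one step, the unknown is
  written as \<open>W t * v t\<close> with \<open>W t = exp (k * (t - p))\<close>. In the sup norm of \<open>v\<close> the iteration then
  has the factor \<open>L / k\<close>, and \<open>k\<close> is taken so large that this is at most \<open>1/2\<close>. The contraction
  principle is applied to bounded continuous functions on the whole line, so the image of the
  iteration is extended by constants beyond \<open>{p..q}\<close>.\<close>

lemma lipschitz_ivp_solution_exists: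
  fixes f :: "real \<Rightarrow> real \<Rightarrow> real"
  assumes "p \<le> q"
    and cont: "continuous_on ({p..q} \<times> UNIV) (\<lambda>(t, x). f t x)"
    and lip: "\<And>t x y. t \<in> {p..q} \<Longrightarrow> \<bar>f t x - f t y\<bar> \<le> L * \<bar>x - y\<bar>"
  shows "\<exists>x. x p = x0 \<and> (\<forall>t\<in>{p..q}. (x has_real_derivative f t (x t)) (at t within {p..q}))"
proof -
  \<comment> \<open>The maximum keeps \<open>k\<close> positive when \<open>L \<le> 0\<close>.\<close>
  define k where "k = 2 * max L 1"
  have k: "0 < k" "L \<le> k / 2" by (auto simp: k_def)
  define W where "W t = exp (k * (t - p))" for t :: real
  have W: "continuous_on S W" "0 < W t" "W t \<noteq> 0" for S t
    unfolding W_def by (auto intro!: continuous_intros)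
  define R where "R v t = f t (W t * v t)" for v :: "real \<Rightarrow> real" and t
  have contR: "continuous_on {p..q} (R v)" if v: "continuous_on {p..q} v" for v
  proof -
    have "continuous_on {p..q} ((\<lambda>(t, x). f t x) \<circ> (\<lambda>t. (t, W t * v t)))"
      using v W(1)
      by (intro continuous_on_compose continuous_intros) (auto intro: continuous_on_subset[OF cont])
    then show ?thesis by (simp add: o_def R_def[abs_def])
  qed
  have Rint: "R v integrable_on {p..t}" if "continuous_on {p..q} v" "t \<le> q" for v t
    using contR[OF that(1)] that(2)
    by (intro integrable_continuous_real) (auto elim: continuous_on_subset)
  define P where "P v t = (x0 + integral {p..t} (R v)) / W t" for v t
  have contP: "continuous_on (cbox p q) (P v)" if v: "continuous_on {p..q} v" for v
    unfolding P_def cbox_interval using indefinite_integral_continuous_1[OF Rint[OF v order_refl]] W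
    by (intro continuous_intros) auto
  have "\<exists>u. \<forall>t. apply_bcontfun u t = P (apply_bcontfun v) (clamp p q t)" for v :: "real \<Rightarrow>\<^sub>C real"
    by (rule continuous_on_cbox_bcontfunE[OF contP[OF continuous_on_apply_bcontfun[of _ v]]]) blast
  then have "\<forall>v. \<exists>u. \<forall>t. apply_bcontfun u t = P (apply_bcontfun v) (clamp p q t)" by blast
  from choice[OF this] obtain \<Psi> :: "(real \<Rightarrow>\<^sub>C real) \<Rightarrow> (real \<Rightarrow>\<^sub>C real)"
    where \<Psi>: "\<And>v t. apply_bcontfun (\<Psi> v) t = P (apply_bcontfun v) (clamp p q t)"
    by blast
  have W_integral: "((\<lambda>s. k * W s) has_integral (W t - 1)) {p..t}" if "p \<le> t" for t
  proof -
    have "((\<lambda>s. k * W s) has_integral (W t - W p)) {p..t}"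
      using that by (intro fundamental_theorem_of_calculus)
        (auto simp: W_def simp flip: has_real_derivative_iff_has_vector_derivative
           intro!: derivative_eq_intros)
    then show ?thesis by (simp add: W_def)
  qed
  have contract: "\<bar>P (apply_bcontfun u) t - P (apply_bcontfun v) t\<bar> \<le> 1/2 * dist u v"
    if t: "t \<in> {p..q}" for u v :: "real \<Rightarrow>\<^sub>C real" and t
  proof -
    have diff: "norm (R u s - R v s) \<le> (k * W s) * (dist u v / 2)" if s: "s \<in> {p..t}" for s
    proof -
      have "\<bar>u s - v s\<bar> \<le> dist u v"
        using dist_bounded[of u s v] by (simp add: dist_real_def)
      then have le: "W s * \<bar>u s - v s\<bar> \<le> W s * dist u v"
        using W(2)[of s] by simp
      have "norm (R u s - R v s) \<le> L * \<bar>W s * u s - W s * v s\<bar>"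
        using lip[of s] s t by (simp add: R_def)
      also have "\<bar>W s * u s - W s * v s\<bar> = W s * \<bar>u s - v s\<bar>"
        using W(2)[of s] by (simp add: abs_mult flip: right_diff_distrib)
      also have "L * (W s * \<bar>u s - v s\<bar>) \<le> (k / 2) * (W s * dist u v)"
        using k W(2)[of s] le by (intro mult_mono) auto
      finally show ?thesis by (simp add: mult_ac)
    qed
    have bound: "((\<lambda>s. (k * W s) * (dist u v / 2)) has_integral (W t - 1) * (dist u v / 2)) {p..t}"
      using W_integral[of t] t by (intro has_integral_mult_left) auto
    have "norm (integral {p..t} (\<lambda>s. R u s - R v s)) \<le> integral {p..t} (\<lambda>s. (k * W s) * (dist u v / 2))"
      using t by (intro integral_norm_bound_integral integrable_diff Rint
        has_integral_integrable[OF bound] diff) auto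
    also have "\<dots> = (W t - 1) * (dist u v / 2)"
      using bound by (rule integral_unique)
    also have "\<dots> \<le> W t * (dist u v / 2)"
      by (intro mult_right_mono) auto
    also have "integral {p..t} (\<lambda>s. R u s - R v s) = integral {p..t} (R u) - integral {p..t} (R v)"
      using t by (intro Henstock_Kurzweil_Integration.integral_diff Rint) auto
    finally have "\<bar>integral {p..t} (R u) - integral {p..t} (R v)\<bar> \<le> W t * (dist u v / 2)"
      by simp
    then have "\<bar>integral {p..t} (R u) - integral {p..t} (R v)\<bar> / W t \<le> dist u v / 2"
      using W(2)[of t] by (simp add: pos_divide_le_eq mult.commute)
    moreover have "P u t - P v t = (integral {p..t} (R u) - integral {p..t} (R v)) / W t"
      unfolding P_def diff_divide_distrib[symmetric] by simp
    ultimately show ?thesis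
      using W(2)[of t] by (simp add: abs_divide)
  qed
  have "dist (\<Psi> u) (\<Psi> v) \<le> 1/2 * dist u v" for u v
  proof (rule dist_bound)
    fix t
    have "clamp p q t \<in> {p..q}"
      using clamp_in_interval[of p q t] \<open>p \<le> q\<close> by simp
    then show "dist (\<Psi> u t) (\<Psi> v t) \<le> 1/2 * dist u v"
      unfolding \<Psi> dist_real_def by (rule contract)
  qed
  then have "\<forall>u v. dist (\<Psi> u) (\<Psi> v) \<le> 1/2 * dist u v" by blast
  then have "\<exists>!v. \<Psi> v = v"
    by (rule banach_fix_type[rotated 2]) auto
  then obtain v where v: "\<Psi> v = v" by blast
  define x where "x t = W t * v t" for t
  have x_eq: "x t = x0 + integral {p..t} (\<lambda>s. f s (x s))" if "t \<in> {p..q}" for t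
  proof -
    have "v t = P v t"
      using \<Psi>[of v t] that by (simp add: v)
    then show ?thesis
      using W(3)[of t] by (simp add: x_def P_def R_def[abs_def])
  qed
  have contf: "continuous_on {p..q} (\<lambda>s. f s (x s))"
    using contR[of v] by (simp add: R_def[abs_def] x_def)
  show ?thesis
  proof (intro exI[of _ x] conjI ballI)
    show "x p = x0" using x_eq[of p] \<open>p \<le> q\<close> by simp
    fix t assume t: "t \<in> {p..q}"
    have "((\<lambda>t. x0 + integral {p..t} (\<lambda>s. f s (x s))) has_real_derivative 0 + f t (x t))
        (at t within {p..q})"
      by (intro DERIV_add DERIV_const integral_has_real_derivative contf t)
    then have "((\<lambda>t. x0 + integral {p..t} (\<lambda>s. f s (x s))) has_real_derivative f t (x t))
        (at t within {p..q})" by simp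
    then show "(x has_real_derivative f t (x t)) (at t within {p..q})"
      by (rule has_field_derivative_transform_within[OF _ zero_less_one t]) (rule x_eq[symmetric])
  qed
qed

section \<open>Comparison and uniqueness for the cubic equation\<close>

lemma cubic_solution_subset:
  "cubic_solution a b c d I y \<Longrightarrow> J \<subseteq> I \<Longrightarrow> cubic_solution a b c d J y"
  unfolding cubic_solution_def by (meson has_field_derivative_subset subsetD)

lemma cubic_subsolution_subset:
  "cubic_subsolution a b c d I y \<Longrightarrow> J \<subseteq> I \<Longrightarrow> cubic_subsolution a b c d J y"
  unfolding cubic_subsolution_def by (meson has_field_derivative_subset subsetD)

lemma cubic_solution_imp_subsolution:
  "cubic_solution a b c d I y \<Longrightarrow> cubic_subsolution a b c d I y"
  unfolding cubic_solution_def cubic_subsolution_def by fastforce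

lemma cubic_subsolution_continuous_on:
  "cubic_subsolution a b c d I y \<Longrightarrow> continuous_on I y"
  unfolding cubic_subsolution_def
  by (metis DERIV_continuous_on)

lemma cubic_solution_continuous_on:
  "cubic_solution a b c d I y \<Longrightarrow> continuous_on I y"
  by (intro cubic_subsolution_continuous_on cubic_solution_imp_subsolution)

lemma cubic_solution_derivative:
  assumes "cubic_solution a b c d I y" "t \<in> I"
  shows "(y has_real_derivative - (a t * y t^3 + b t * y t^2 + c t * y t + d t)) (at t within I)"
proof -
  obtain D where D: "(y has_real_derivative D) (at t within I)"
      "D + a t * y t^3 + b t * y t^2 + c t * y t + d t = 0"
    using assms unfolding cubic_solution_def by blast
  then have "D = - (a t * y t^3 + b t * y t^2 + c t * y t + d t)" by simp
  with D(1) show ?thesis by simp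
qed

text \<open>With \<open>g\<close> the divided difference, \<open>w = y - \<eta>\<close> satisfies \<open>w' + g * w \<ge> 0\<close>, so that
  \<open>exp (integral {p..t} g) * w t\<close> is nondecreasing.\<close>

lemma cubic_subsolution_le_solution:
  assumes "p \<le> q" and cont: "continuous_on {p..q} a" "continuous_on {p..q} b" "continuous_on {p..q} c"
    and \<eta>: "cubic_subsolution a b c d {p..q} \<eta>" and y: "cubic_solution a b c d {p..q} y"
  shows "\<eta> p \<le> y p \<Longrightarrow> \<eta> q \<le> y q" and "\<eta> p < y p \<Longrightarrow> \<eta> q < y q"
proof -
  define g where "g t = cubic_quotient (a t) (b t) (c t) (y t) (\<eta> t)" for t
  have g: "continuous_on {p..q} g"
    unfolding g_def using cont cubic_solution_continuous_on[OF y] cubic_subsolution_continuous_on[OF \<eta>]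
    by (rule continuous_on_cubic_quotient)
  have "\<exists>D. (\<eta> has_real_derivative D) (at t within {p..q}) \<and>
      D + a t * \<eta> t^3 + b t * \<eta> t^2 + c t * \<eta> t + d t \<le> 0" if "t \<in> {p..q}" for t
    using \<eta> that unfolding cubic_subsolution_def by blast
  then obtain \<eta>' where \<eta>':
    "\<And>t. t \<in> {p..q} \<Longrightarrow> (\<eta> has_real_derivative \<eta>' t) (at t within {p..q})"
    "\<And>t. t \<in> {p..q} \<Longrightarrow> \<eta>' t + a t * \<eta> t^3 + b t * \<eta> t^2 + c t * \<eta> t + d t \<le> 0"
    by metis
  define D where "D t = - (a t * y t^3 + b t * y t^2 + c t * y t + d t) - \<eta>' t" for t
  have D: "((\<lambda>t. y t - \<eta> t) has_real_derivative D t) (at t within {p..q})" if "t \<in> {p..q}" for t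
    unfolding D_def using cubic_solution_derivative[OF y that] \<eta>'(1)[OF that] by (rule DERIV_diff)
  have "exp (integral {p..p} g) * (y p - \<eta> p) \<le> exp (integral {p..q} g) * (y q - \<eta> q)"
  proof (rule mono_of_nonneg_derivative_within[OF \<open>p \<le> q\<close>])
    fix t assume t: "t \<in> {p..q}"
    show "((\<lambda>t. exp (integral {p..t} g) * (y t - \<eta> t)) has_real_derivative
        exp (integral {p..t} g) * (D t + g t * (y t - \<eta> t))) (at t within {p..q})"
      using g t D[OF t] by (rule integrating_factor_derivative)
    have "0 \<le> D t + g t * (y t - \<eta> t)"
      using \<eta>'(2)[OF t] unfolding D_def g_def cubic_diff[symmetric] by simp
    then show "0 \<le> exp (integral {p..t} g) * (D t + g t * (y t - \<eta> t))" by simp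
  qed
  then have *: "y p - \<eta> p \<le> exp (integral {p..q} g) * (y q - \<eta> q)" by simp
  show "\<eta> q \<le> y q" if "\<eta> p \<le> y p"
  proof -
    have "0 \<le> exp (integral {p..q} g) * (y q - \<eta> q)" using * that by linarith
    then show ?thesis by (simp add: zero_le_mult_iff)
  qed
  show "\<eta> q < y q" if "\<eta> p < y p"
  proof -
    have "0 < exp (integral {p..q} g) * (y q - \<eta> q)" using * that by linarith
    then show ?thesis by (simp add: zero_less_mult_iff)
  qed
qed

lemma cubic_solution_unique:
  assumes "p \<le> q" "continuous_on {p..q} a" "continuous_on {p..q} b" "continuous_on {p..q} c"
    and "cubic_solution a b c d {p..q} y" "cubic_solution a b c d {p..q} z" "y p = z p"
  shows "y q = z q"
  using cubic_subsolution_le_solution(1)[OF assms(1-4) cubic_solution_imp_subsolution]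
  using assms(5-7) by (metis order_antisym order_refl)

section \<open>Existence from an a priori bound\<close>

lemma clip_abs_le: "0 \<le> M \<Longrightarrow> \<bar>max (- M) (min M x)\<bar> \<le> M" for x M :: real
  by (auto simp: max_def min_def)

lemma clip_lipschitz: "\<bar>max (- M) (min M x) - max (- M) (min M y)\<bar> \<le> \<bar>x - y\<bar>" for x y M :: real
  by (auto simp: max_def min_def)

lemma cubic_quotient_abs_le:
  assumes "\<bar>a\<bar> \<le> A" "\<bar>b\<bar> \<le> B" "\<bar>c\<bar> \<le> C" "\<bar>u\<bar> \<le> M" "\<bar>v\<bar> \<le> M"
  shows "\<bar>cubic_quotient a b c u v\<bar> \<le> A * (3 * M^2) + B * (2 * M) + C"
proof -
  have M: "0 \<le> M" using assms(4) by simp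
  have "\<bar>u^2\<bar> \<le> M^2" "\<bar>v^2\<bar> \<le> M^2"
    using power_mono[OF assms(4), of 2] power_mono[OF assms(5), of 2] by auto
  moreover have "\<bar>u * v\<bar> \<le> M^2"
    unfolding power2_eq_square abs_mult using assms(4,5) M by (intro mult_mono) auto
  ultimately have "\<bar>u^2 + u * v + v^2\<bar> \<le> 3 * M^2" by linarith
  then have "\<bar>a * (u^2 + u * v + v^2)\<bar> \<le> A * (3 * M^2)"
    unfolding abs_mult using assms(1) by (intro mult_mono) auto
  moreover have "\<bar>u + v\<bar> \<le> 2 * M" using assms(4,5) by linarith
  then have "\<bar>b * (u + v)\<bar> \<le> B * (2 * M)"
    unfolding abs_mult using assms(2) by (intro mult_mono) auto
  ultimately show ?thesis
    unfolding cubic_quotient_def using assms(3) by linarith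
qed

lemma continuous_on_Icc_abs_bounded:
  fixes f :: "real \<Rightarrow> real"
  assumes "continuous_on {p..q} f"
  obtains K where "\<And>t. t \<in> {p..q} \<Longrightarrow> \<bar>f t\<bar> \<le> K"
proof -
  have "bounded (f ` {p..q})"
    using assms by (intro compact_imp_bounded compact_continuous_image) auto
  then obtain K where "\<forall>x\<in>f ` {p..q}. norm x \<le> K" by (auto simp: bounded_iff)
  then show thesis by (intro that[of K]) simp
qed

text \<open>The right-hand side is made Lipschitz by clipping its argument to \<open>[-M, M]\<close>. The solution of the
  clipped problem solves the original one until \<open>\<bar>y\<bar>\<close> first reaches \<open>M\<close>, and the a priori bound
  at that time shows that this never happens.\<close>

lemma cubic_solution_exists_of_a_priori_bound:
  assumes "p \<le> q"
    and cont: "continuous_on {p..q} a" "continuous_on {p..q} b" "continuous_on {p..q} c" "continuous_on {p..q} d"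
    and a_priori: "\<And>s y. s \<in> {p..q} \<Longrightarrow> cubic_solution a b c d {p..s} y \<Longrightarrow> y p = x0 \<Longrightarrow> \<bar>y s\<bar> < M"
    and "\<bar>x0\<bar> < M"
  obtains y where "cubic_solution a b c d {p..q} y" "y p = x0"
proof -
  define \<pi> where "\<pi> x = max (- M) (min M x)" for x
  have M: "0 \<le> M" using \<open>\<bar>x0\<bar> < M\<close> by simp
  define f where "f t x = - (a t * \<pi> x^3 + b t * \<pi> x^2 + c t * \<pi> x + d t)" for t x
  obtain A where A: "\<And>t. t \<in> {p..q} \<Longrightarrow> \<bar>a t\<bar> \<le> A"
    using continuous_on_Icc_abs_bounded[OF cont(1)] by blast
  obtain B where B: "\<And>t. t \<in> {p..q} \<Longrightarrow> \<bar>b t\<bar> \<le> B"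
    using continuous_on_Icc_abs_bounded[OF cont(2)] by blast
  obtain C where C: "\<And>t. t \<in> {p..q} \<Longrightarrow> \<bar>c t\<bar> \<le> C"
    using continuous_on_Icc_abs_bounded[OF cont(3)] by blast
  have fst_cont: "continuous_on ({p..q} \<times> UNIV) (\<lambda>z. h (fst z))" if "continuous_on {p..q} h"
    for h :: "real \<Rightarrow> real"
    using that by (rule continuous_on_compose2[OF _ continuous_on_fst[OF continuous_on_id]]) auto
  have f_cont: "continuous_on ({p..q} \<times> UNIV) (\<lambda>(t, x). f t x)"
    unfolding f_def \<pi>_def case_prod_unfold
    using cont[THEN fst_cont] by (intro continuous_intros)
  have f_lip: "\<bar>f t x - f t y\<bar> \<le> (A * (3 * M^2) + B * (2 * M) + C) * \<bar>x - y\<bar>" if t: "t \<in> {p..q}" for t x y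
  proof -
    have "f t x - f t y = - (cubic_quotient (a t) (b t) (c t) (\<pi> x) (\<pi> y) * (\<pi> x - \<pi> y))"
      unfolding f_def cubic_diff[symmetric] by simp
    then have "\<bar>f t x - f t y\<bar> = \<bar>cubic_quotient (a t) (b t) (c t) (\<pi> x) (\<pi> y)\<bar> * \<bar>\<pi> x - \<pi> y\<bar>"
      by (simp only: abs_minus_cancel abs_mult)
    also have "\<dots> \<le> (A * (3 * M^2) + B * (2 * M) + C) * \<bar>x - y\<bar>"
    proof (rule mult_mono)
      show quot: "\<bar>cubic_quotient (a t) (b t) (c t) (\<pi> x) (\<pi> y)\<bar> \<le> A * (3 * M^2) + B * (2 * M) + C"
        unfolding \<pi>_def by (intro cubic_quotient_abs_le A B C t clip_abs_le M)
      show "\<bar>\<pi> x - \<pi> y\<bar> \<le> \<bar>x - y\<bar>"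
        unfolding \<pi>_def by (rule clip_lipschitz)
      show "0 \<le> A * (3 * M^2) + B * (2 * M) + C"
        using order_trans[OF abs_ge_zero quot] .
    qed simp
    finally show ?thesis .
  qed
  obtain y where y: "y p = x0"
      "\<And>t. t \<in> {p..q} \<Longrightarrow> (y has_real_derivative f t (y t)) (at t within {p..q})"
    using lipschitz_ivp_solution_exists[OF \<open>p \<le> q\<close> f_cont f_lip] by blast
  from y(2) have yc: "continuous_on {p..q} y" by (rule DERIV_continuous_on)
  have sol: "cubic_solution a b c d {p..s} y"
    if s: "s \<in> {p..q}" and le: "\<And>t. t \<in> {p..s} \<Longrightarrow> \<bar>y t\<bar> \<le> M" for s
    unfolding cubic_solution_def
  proof
    fix t assume t: "t \<in> {p..s}"
    then have "(y has_real_derivative f t (y t)) (at t within {p..s})"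
      using y(2)[of t] s by (auto elim: has_field_derivative_subset)
    moreover have "\<pi> (y t) = y t" using le[OF t] by (auto simp: \<pi>_def)
    ultimately show "\<exists>D. (y has_real_derivative D) (at t within {p..s}) \<and>
        D + a t * y t^3 + b t * y t^2 + c t * y t + d t = 0"
      by (intro exI[of _ "f t (y t)"]) (simp add: f_def)
  qed
  have "\<bar>y t\<bar> < M" if t: "t \<in> {p..q}" for t
  proof (rule ccontr)
    assume "\<not> \<bar>y t\<bar> < M"
    have first_hit: "\<exists>r. p \<le> r \<and> r \<le> s \<and> \<bar>y r\<bar> = M" if "s \<in> {p..q}" "M \<le> \<bar>y s\<bar>" for s
      using that \<open>\<bar>x0\<bar> < M\<close> y(1) continuous_on_subset[OF yc, of "{p..s}"]
      by (intro IVT') (auto intro!: continuous_intros)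
    \<comment> \<open>The least element of \<open>Z\<close> is the time at which \<open>\<bar>y\<bar>\<close> first reaches \<open>M\<close>.\<close>
    define Z where "Z = {s \<in> {p..q}. \<bar>y s\<bar> = M}"
    obtain r where "p \<le> r" "r \<le> t" "\<bar>y r\<bar> = M"
      using first_hit[OF t] \<open>\<not> \<bar>y t\<bar> < M\<close> by auto
    then have "r \<in> Z" using t by (simp add: Z_def)
    then have "Z \<noteq> {}" by blast
    moreover have "closed Z"
      unfolding Z_def using yc
      by (intro continuous_closed_preimage_constant continuous_intros) auto
    moreover have "bounded Z"
      by (rule bounded_subset[of "{p..q}"]) (auto simp: Z_def)
    ultimately obtain s where s: "s \<in> Z" "\<And>r. r \<in> Z \<Longrightarrow> s \<le> r"
      using compact_attains_inf[of Z] by (auto simp: compact_eq_bounded_closed)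
    have "\<bar>y r\<bar> \<le> M" if r: "r \<in> {p..s}" for r
    proof (rule ccontr)
      assume "\<not> \<bar>y r\<bar> \<le> M"
      then obtain r' where "p \<le> r'" "r' \<le> r" "\<bar>y r'\<bar> = M"
        using first_hit[of r] r s(1) by (force simp: Z_def)
      moreover from this have "s \<le> r'"
        using s r by (intro s(2)) (auto simp: Z_def)
      ultimately have "r = r'" using r by simp
      with \<open>\<not> \<bar>y r\<bar> \<le> M\<close> \<open>\<bar>y r'\<bar> = M\<close> show False by simp
    qed
    then have "\<bar>y s\<bar> < M"
      using s(1) y(1) by (intro a_priori sol) (auto simp: Z_def)
    then show False using s(1) by (simp add: Z_def)
  qed
  then have "cubic_solution a b c d {p..q} y"
    using \<open>p \<le> q\<close> by (intro sol) (auto intro: less_imp_le)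
  with y(1) show thesis by (intro that)
qed

lemma Icc_subset_right_open_ivl: "ereal q < T \<Longrightarrow> {p..q} \<subseteq> right_open_ivl p T"
  unfolding right_open_ivl_def by auto (metis ereal_less_eq(3) le_less_trans)

text \<open>By uniqueness the solutions on the intervals \<open>{p..q}\<close> extend one another, and so glue to one
  on \<open>[p, T)\<close>.\<close>

lemma cubic_ivp_solution_exists_onI:
  assumes "ereal p < T"
    and cont: "continuous_on (right_open_ivl p T) a" "continuous_on (right_open_ivl p T) b"
      "continuous_on (right_open_ivl p T) c"
    and ex: "\<And>q. p \<le> q \<Longrightarrow> ereal q < T \<Longrightarrow> \<exists>y. cubic_solution a b c d {p..q} y \<and> y p = x0"
  shows "cubic_ivp_solution_exists_on a b c d p T x0"
proof -
  define y where "y t = (SOME z. cubic_solution a b c d {p..t} z \<and> z p = x0) t" for t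
  have y_eq: "z t = y t"
    if "cubic_solution a b c d {p..t} z" "z p = x0" "p \<le> t" "ereal t < T" for z t
  proof -
    define u where "u = (SOME z. cubic_solution a b c d {p..t} z \<and> z p = x0)"
    have u: "cubic_solution a b c d {p..t} u \<and> u p = x0"
      unfolding u_def using ex[OF that(3,4)] by (rule someI_ex)
    have "z t = u t"
      using that(2) u cont[THEN continuous_on_subset, OF Icc_subset_right_open_ivl[OF that(4)]]
      by (intro cubic_solution_unique[OF that(3) _ _ _ that(1)]) simp_all
    then show ?thesis by (simp add: y_def u_def)
  qed
  have y_sol: "\<exists>D. (y has_real_derivative D) (at t within right_open_ivl p T) \<and>
      D + a t * y t^3 + b t * y t^2 + c t * y t + d t = 0" if t: "t \<in> right_open_ivl p T" for t
  proof -
    have tT: "p \<le> t" "ereal t < T" using t by (auto simp: right_open_ivl_def)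
    obtain q where q: "t < q" "ereal q < T"
      using ereal_dense2[OF tT(2)] by auto
    then obtain z where z: "cubic_solution a b c d {p..q} z" "z p = x0"
      using ex[of q] tT by auto
    have zy: "z s = y s" if "s \<in> {p..q}" for s
    proof (rule y_eq)
      show "cubic_solution a b c d {p..s} z"
        using that by (intro cubic_solution_subset[OF z(1)]) auto
      show "p \<le> s" "ereal s < T"
        using that Icc_subset_right_open_ivl[OF q(2), of p] by (auto simp: right_open_ivl_def)
    qed (rule z(2))
    obtain D where D: "(z has_real_derivative D) (at t within {p..q})"
        "D + a t * z t^3 + b t * z t^2 + c t * z t + d t = 0"
      using z(1) tT(1) q(1) unfolding cubic_solution_def by (force intro: less_imp_le)
    have "(y has_real_derivative D) (at t within {p..q})"
      using D(1) zy tT(1) q(1)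
      by (intro has_field_derivative_transform_within[OF D(1) zero_less_one]) auto
    moreover have "at t within {p..q} = at t within right_open_ivl p T"
      using q Icc_subset_right_open_ivl[OF q(2), of p]
      by (intro at_within_nhd[of t "{..<q}"]) (auto simp: right_open_ivl_def)
    ultimately show ?thesis
      using D(2) zy[of t] tT(1) q(1) by auto
  qed
  have yp: "y p = x0"
    using ex[of p] y_eq[of p] \<open>ereal p < T\<close> by force
  show ?thesis
    unfolding cubic_ivp_solution_exists_on_def
  proof (intro exI[of _ y] conjI allI impI ballI)
    show "cubic_solution a b c d (right_open_ivl p T) y"
      unfolding cubic_solution_def using y_sol by blast
    show "y p = x0" by (rule yp)
    fix T' z t assume z: "ereal p < T' \<and> T' \<le> T \<and>
        cubic_solution a b c d (right_open_ivl p T') z \<and> z p = x0" and "t \<in> right_open_ivl p T'"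
    then have t: "p \<le> t" "ereal t < T'" by (auto simp: right_open_ivl_def)
    show "z t = y t"
      using z t cubic_solution_subset[OF _ Icc_subset_right_open_ivl[OF t(2)]]
      by (intro y_eq) auto
  qed
qed

section \<open>The comparison theorem\<close>

text \<open>The difference \<open>w = y1 - y\<close> solves \<open>w' + g * w + F = 0\<close>, where \<open>g\<close> is the divided difference of
  the equation for \<open>y\<close>, and \<open>F\<close>, the bracket in the integral condition, is up to sign the defect
  of \<open>y1\<close> in that equation. Completing the square makes \<open>c - b^2 / a\<close> a majorant of \<open>g\<close> off \<open>N\<close>.\<close>

lemma cubic_solution_le_of_integral_condition:
  assumes "p \<le> q"
    and cont: "continuous_on {p..q} a" "continuous_on {p..q} b" "continuous_on {p..q} c" "continuous_on {p..q} d"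
      "continuous_on {p..q} a1" "continuous_on {p..q} b1" "continuous_on {p..q} c1" "continuous_on {p..q} d1"
    and y1: "cubic_solution a1 b1 c1 d1 {p..q} y1" and y: "cubic_solution a b c d {p..q} y"
    and N: "negligible N" and neg: "\<And>t. t \<in> {p..q} - N \<Longrightarrow> a t < 0"
    and H: "(\<lambda>t. c t - b t^2 / a t) integrable_on {p..q}"
    and bound: "\<And>t. t \<in> {p..q} \<Longrightarrow>
      integral {p..t} (\<lambda>\<tau>. exp (integral {p..\<tau>} (\<lambda>s. c s - b s^2 / a s)) *
        ((a1 \<tau> - a \<tau>) * y1 \<tau>^3 + (b1 \<tau> - b \<tau>) * y1 \<tau>^2 + (c1 \<tau> - c \<tau>) * y1 \<tau> + d1 \<tau> - d \<tau>))
      \<le> y1 p - y p"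
  shows "y q \<le> y1 q" and "y p < y1 p \<Longrightarrow> y q < y1 q"
proof -
  define g where "g t = cubic_quotient (a t) (b t) (c t) (y1 t) (y t)" for t
  define F where "F \<tau> = (a1 \<tau> - a \<tau>) * y1 \<tau>^3 + (b1 \<tau> - b \<tau>) * y1 \<tau>^2
      + (c1 \<tau> - c \<tau>) * y1 \<tau> + d1 \<tau> - d \<tau>" for \<tau>
  note cont_y = cubic_solution_continuous_on[OF y1] cubic_solution_continuous_on[OF y]
  have g: "continuous_on {p..q} g"
    unfolding g_def using cont(1-3) cont_y by (rule continuous_on_cubic_quotient)
  have F: "continuous_on {p..q} F"
    unfolding F_def using cont cont_y by (intro continuous_intros)
  have w: "((\<lambda>t. y1 t - y t) has_real_derivative - (g t * (y1 t - y t)) - F t) (at t within {p..q})"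
    if t: "t \<in> {p..q}" for t
  proof -
    have "- (a1 t * y1 t^3 + b1 t * y1 t^2 + c1 t * y1 t + d1 t)
        - - (a t * y t^3 + b t * y t^2 + c t * y t + d t) = - (g t * (y1 t - y t)) - F t"
      unfolding g_def cubic_diff[symmetric] F_def by (simp add: algebra_simps)
    then show ?thesis
      using DERIV_diff[OF cubic_solution_derivative[OF y1 t] cubic_solution_derivative[OF y t]] by simp
  qed
  have part: "{s..t} \<subseteq> {p..q}" if "p \<le> s" "t \<le> q" for s t
    using that by auto
  have le: "integral {s..t} g \<le> integral {s..t} (\<lambda>t. c t - b t^2 / a t)"
    if "p \<le> s" "s \<le> t" "t \<le> q" for s t
    unfolding g_def
    using cont cont_y neg part[OF that(1,3)] N integrable_subinterval_real[OF H part[OF that(1,3)]]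
    by (intro integral_cubic_quotient(1)[where N = N]) (auto elim: continuous_on_subset)
  have less: "integral {p..t} g < integral {p..t} (\<lambda>t. c t - b t^2 / a t)"
    if "y1 p \<noteq> y p" "p < t" "t \<le> q" for t
    unfolding g_def
    using cont cont_y neg part[of p t] that N integrable_subinterval_real[OF H part[of p t]]
    by (intro integral_cubic_quotient(2)[where N = N]) (auto elim: continuous_on_subset)
  note comparison = linear_comparison_with_majorant[OF \<open>p \<le> q\<close> g F H w le bound[folded F_def]]
  show "y q \<le> y1 q" using comparison(1) by simp
  show "y q < y1 q" if "y p < y1 p" using comparison(2) less that by simp
qed

theorem theorem3p2:
  fixes t0 :: real and \<tau>0 :: ereal
    and a b c d a1 b1 c1 d1 y1 \<eta> :: "real \<Rightarrow> real" and \<gamma> :: real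
  assumes "ereal t0 < \<tau>0"
    and "continuous_on (right_open_ivl t0 \<tau>0) a" and "continuous_on (right_open_ivl t0 \<tau>0) b"
    and "continuous_on (right_open_ivl t0 \<tau>0) c" and "continuous_on (right_open_ivl t0 \<tau>0) d"
    and "continuous_on (right_open_ivl t0 \<tau>0) a1" and "continuous_on (right_open_ivl t0 \<tau>0) b1"
    and "continuous_on (right_open_ivl t0 \<tau>0) c1" and "continuous_on (right_open_ivl t0 \<tau>0) d1"
    and "cubic_solution a1 b1 c1 d1 (right_open_ivl t0 \<tau>0) y1"
    and "cubic_subsolution a b c d (right_open_ivl t0 \<tau>0) \<eta>"
    and "\<eta> t0 \<le> y1 t0"
    and "AE t in lebesgue. t \<in> right_open_ivl t0 \<tau>0 \<longrightarrow> a t < 0"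
    and "\<And>t1. t0 < t1 \<Longrightarrow> ereal t1 < \<tau>0 \<Longrightarrow>
           set_integrable lebesgue {t0..t1} (\<lambda>t. b t ^ 2 / a t)"
    and "\<gamma> \<in> {\<eta> t0..y1 t0}"
    and "\<And>t. t \<in> right_open_ivl t0 \<tau>0 \<Longrightarrow>
           \<gamma> - y1 t0 +
           (LINT \<tau>:{t0..t}|lebesgue.
              exp (LINT s:{t0..\<tau>}|lebesgue. c s - b s ^ 2 / a s) *
              ((a1 \<tau> - a \<tau>) * y1 \<tau> ^ 3 + (b1 \<tau> - b \<tau>) * y1 \<tau> ^ 2
                + (c1 \<tau> - c \<tau>) * y1 \<tau> + d1 \<tau> - d \<tau>)) \<le> 0"
  shows "\<forall>y0\<in>{\<eta> t0..\<gamma>}.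
           cubic_ivp_solution_exists_on a b c d t0 \<tau>0 y0 \<and>
           (\<forall>y. cubic_solution a b c d (right_open_ivl t0 \<tau>0) y \<and> y t0 = y0 \<longrightarrow>
              (\<forall>t\<in>right_open_ivl t0 \<tau>0. \<eta> t \<le> y t \<and> y t \<le> y1 t) \<and>
              (\<eta> t0 < y t0 \<longrightarrow> (\<forall>t\<in>right_open_ivl t0 \<tau>0. \<eta> t < y t)) \<and>
              (y t0 < y1 t0 \<longrightarrow> (\<forall>t\<in>right_open_ivl t0 \<tau>0. y t < y1 t)))"
proof
  fix y0 assume y0: "y0 \<in> {\<eta> t0..\<gamma>}"
  let ?I = "right_open_ivl t0 \<tau>0"
  define H where "H s = c s - b s^2 / a s" for s
  define F where "F \<tau> = (a1 \<tau> - a \<tau>) * y1 \<tau>^3 + (b1 \<tau> - b \<tau>) * y1 \<tau>^2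
      + (c1 \<tau> - c \<tau>) * y1 \<tau> + d1 \<tau> - d \<tau>" for \<tau>
  have sub: "{t0..q} \<subseteq> ?I" if "q \<in> ?I" for q
    using that Icc_subset_right_open_ivl by (simp add: right_open_ivl_def)
  have cont: "continuous_on {t0..q} a" "continuous_on {t0..q} b" "continuous_on {t0..q} c"
    "continuous_on {t0..q} d" "continuous_on {t0..q} a1" "continuous_on {t0..q} b1"
    "continuous_on {t0..q} c1" "continuous_on {t0..q} d1" if "q \<in> ?I" for q
    using sub[OF that] assms(2-9) by (auto elim: continuous_on_subset)
  obtain N where N: "negligible N" "{t. \<not> (t \<in> ?I \<longrightarrow> a t < 0)} \<subseteq> N"
    using assms(13) unfolding eventually_ae_filter_negligible by blast
  have H_abs: "H absolutely_integrable_on {t0..q}" if q: "q \<in> ?I" for q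
  proof -
    \<comment> \<open>Integrability is assumed on nondegenerate intervals only; going slightly beyond \<open>q\<close> covers
      \<open>q = t0\<close>.\<close>
    obtain r where r: "q < r" "ereal r < \<tau>0"
      using q ereal_dense2[of q \<tau>0] by (auto simp: right_open_ivl_def)
    then have "(\<lambda>t. b t^2 / a t) absolutely_integrable_on {t0..r}"
      using q by (intro assms(14)) (auto simp: right_open_ivl_def)
    then have "(\<lambda>t. b t^2 / a t) absolutely_integrable_on {t0..q}"
      by (rule set_integrable_subset) (use r in auto)
    then show ?thesis
      unfolding H_def using absolutely_integrable_continuous_real[OF cont(3)[OF q]]
      by (intro set_integral_diff(1))
  qed
  have bound: "integral {t0..q} (\<lambda>\<tau>. exp (integral {t0..\<tau>} H) * F \<tau>) \<le> y1 t0 - y0"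
    if q: "q \<in> ?I" for q
  proof -
    have "continuous_on {t0..q} (\<lambda>\<tau>. exp (integral {t0..\<tau>} H))"
      using indefinite_integral_continuous_1 set_lebesgue_integral_eq_integral(1)[OF H_abs[OF q]]
      by (intro continuous_intros) auto
    moreover have "continuous_on {t0..q} F"
      unfolding F_def using cont[OF q] cubic_solution_continuous_on[OF cubic_solution_subset[OF assms(10) sub[OF q]]]
      by (intro continuous_intros)
    ultimately have "(\<lambda>\<tau>. exp (integral {t0..\<tau>} H) * F \<tau>) absolutely_integrable_on {t0..q}"
      by (intro absolutely_integrable_continuous_real continuous_on_mult)
    then have "integral {t0..q} (\<lambda>\<tau>. exp (integral {t0..\<tau>} H) * F \<tau>)
        = (LINT \<tau>:{t0..q}|lebesgue. exp (integral {t0..\<tau>} H) * F \<tau>)"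
      by (simp add: set_lebesgue_integral_eq_integral(2))
    also have "\<dots> = (LINT \<tau>:{t0..q}|lebesgue. exp (LINT s:{t0..\<tau>}|lebesgue. H s) * F \<tau>)"
      using sub[OF q] set_lebesgue_integral_eq_integral(2)[OF H_abs]
      by (intro set_lebesgue_integral_cong) auto
    also have "\<dots> \<le> y1 t0 - \<gamma>"
      using assms(16)[OF q] by (simp add: H_def F_def)
    also have "\<dots> \<le> y1 t0 - y0" using y0 by simp
    finally show ?thesis .
  qed
  have lower: "\<eta> t0 \<le> y t0 \<Longrightarrow> \<eta> q \<le> y q" "\<eta> t0 < y t0 \<Longrightarrow> \<eta> q < y q"
    if "q \<in> ?I" "cubic_solution a b c d {t0..q} y" for q y
    using that cubic_subsolution_le_solution[OF _ cont(1-3) cubic_subsolution_subset[OF assms(11) sub]]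
    by (auto simp: right_open_ivl_def)
  have upper: "y q \<le> y1 q" "y t0 < y1 t0 \<Longrightarrow> y q < y1 q"
    if q: "q \<in> ?I" and y: "cubic_solution a b c d {t0..q} y" "y t0 = y0" for q y
  proof -
    have "t0 \<le> q" using q by (simp add: right_open_ivl_def)
    note comparison = cubic_solution_le_of_integral_condition[OF this cont[OF q]
        cubic_solution_subset[OF assms(10) sub[OF q]] y(1) N(1) _
        set_lebesgue_integral_eq_integral(1)[OF H_abs[OF q], unfolded H_def]]
    have neg: "a t < 0" if "t \<in> {t0..q} - N" for t
      using that N(2) sub[OF q] by blast
    have bd: "integral {t0..t} (\<lambda>\<tau>. exp (integral {t0..\<tau>} (\<lambda>s. c s - b s^2 / a s)) *
        ((a1 \<tau> - a \<tau>) * y1 \<tau>^3 + (b1 \<tau> - b \<tau>) * y1 \<tau>^2 + (c1 \<tau> - c \<tau>) * y1 \<tau> + d1 \<tau> - d \<tau>))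
      \<le> y1 t0 - y t0" if "t \<in> {t0..q}" for t
      using bound[of t] that sub[OF q] unfolding H_def F_def y(2) by blast
    show "y q \<le> y1 q" using neg bd by (rule comparison(1))
    show "y t0 < y1 t0 \<Longrightarrow> y q < y1 q" using neg bd by (rule comparison(2))
  qed
  have "\<exists>y. cubic_solution a b c d {t0..q} y \<and> y t0 = y0" if q': "t0 \<le> q" "ereal q < \<tau>0" for q
  proof -
    have q: "q \<in> ?I" using q' by (simp add: right_open_ivl_def)
    obtain K1 where K1: "\<And>t. t \<in> {t0..q} \<Longrightarrow> \<bar>y1 t\<bar> \<le> K1"
      using continuous_on_Icc_abs_bounded cubic_solution_continuous_on[OF cubic_solution_subset[OF assms(10) sub[OF q]]]
      by blast
    obtain K2 where K2: "\<And>t. t \<in> {t0..q} \<Longrightarrow> \<bar>\<eta> t\<bar> \<le> K2"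
      using continuous_on_Icc_abs_bounded cubic_subsolution_continuous_on[OF cubic_subsolution_subset[OF assms(11) sub[OF q]]]
      by blast
    \<comment> \<open>A solution squeezed between \<open>\<eta>\<close> and \<open>y1\<close> cannot reach \<open>\<plusminus>M\<close>.\<close>
    define M where "M = max K1 K2 + 1"
    have between: "\<bar>x\<bar> < M" if "t \<in> {t0..q}" "\<eta> t \<le> x" "x \<le> y1 t" for x t
      using K1[OF that(1)] K2[OF that(1)] that(2,3) by (auto simp: M_def)
    show ?thesis
    proof (rule cubic_solution_exists_of_a_priori_bound[OF q'(1) cont(1-4)[OF q]])
      show "\<bar>y0\<bar> < M" using y0 assms(15) q'(1) by (intro between[of t0]) auto
      show "\<bar>y s\<bar> < M" if "s \<in> {t0..q}" "cubic_solution a b c d {t0..s} y" "y t0 = y0" for s y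
        using that y0 sub[OF q] lower(1)[of s y] upper(1)[of s y] by (intro between[of s]) auto
    qed blast
  qed
  then have "cubic_ivp_solution_exists_on a b c d t0 \<tau>0 y0"
    by (rule cubic_ivp_solution_exists_onI[OF assms(1-4)])
  moreover have "(\<forall>t\<in>?I. \<eta> t \<le> y t \<and> y t \<le> y1 t) \<and>
      (\<eta> t0 < y t0 \<longrightarrow> (\<forall>t\<in>?I. \<eta> t < y t)) \<and> (y t0 < y1 t0 \<longrightarrow> (\<forall>t\<in>?I. y t < y1 t))"
    if y: "cubic_solution a b c d ?I y" "y t0 = y0" for y
  proof -
    have sol: "cubic_solution a b c d {t0..t} y" if "t \<in> ?I" for t
      using y(1) sub[OF that] by (rule cubic_solution_subset)
    have "\<eta> t0 \<le> y t0" using y0 y(2) by simp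
    then show ?thesis
      using lower[OF _ sol] upper[OF _ sol y(2)] by blast
  qed
  ultimately show "cubic_ivp_solution_exists_on a b c d t0 \<tau>0 y0 \<and>
      (\<forall>y. cubic_solution a b c d ?I y \<and> y t0 = y0 \<longrightarrow>
        (\<forall>t\<in>?I. \<eta> t \<le> y t \<and> y t \<le> y1 t) \<and>
        (\<eta> t0 < y t0 \<longrightarrow> (\<forall>t\<in>?I. \<eta> t < y t)) \<and>
        (y t0 < y1 t0 \<longrightarrow> (\<forall>t\<in>?I. y t < y1 t)))"
    by blast
qed

end
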